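(* Let $k\geq 2$ be an integer. For an integer $x\geq 2$ let $X_1^{(x)},\ldots,X_k^{(x)}$ be independent random variables, each uniformly distributed on $\{1,\ldots,x\}$. Then there are constants $0<A_k\le B_k$ such that for all sufficiently large integers $x$, $$A_k\log^{2^k-k-1} x\leq \mathbb{E}\left(\frac{X_1^{(x)}\cdots X_k^{(x)}}{\operatorname{lcm}(X_1^{(x)},\ldots, X_k^{(x)})}\right)\leq B_k\log^{2^k-k-1}x.$$ Equivalently, $\sum_{n_1,\ldots,n_k\le x}\frac{n_1\cdots n_k}{\operatorname{lcm}(n_1,\ldots,n_k)}\asymp x^k\log^{2^k-k-1}x$. *)

theory Defs
  imports "HOL-Probability.Probability" "HOL-Library.Landau_Symbols"
begin

definition prod_over_lcm :: "nat \<Rightarrow> (nat \<Rightarrow> nat) \<Rightarrow> real" where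
  "prod_over_lcm k n = real (\<Prod>i\<in>{1..k}. n i) / real (LCM i\<in>{1..k}. n i)"

definition indep_uniform_vars ::
  "'a measure \<Rightarrow> nat \<Rightarrow> nat \<Rightarrow> (nat \<Rightarrow> 'a \<Rightarrow> nat) \<Rightarrow> bool" where
  "indep_uniform_vars M k x X \<longleftrightarrow>
     prob_space M \<and>
     prob_space.indep_vars M (\<lambda>_. count_space UNIV) X {1..k} \<and>
     (\<forall>i\<in>{1..k}. distr M (count_space UNIV) (X i) = measure_pmf (pmf_of_set {1..x}))"

end

theory Submission
  imports Defs "HOL-Real_Asymp.Real_Asymp"
begin

text \<open>
  Write $f(n) = n_1 \cdots n_k / \mathrm{lcm}(n_1, \dots, n_k)$ and let $\tau$ be the divisor function.

  Upper bound: with $L = \mathrm{lcm}(n_1, \dots, n_{k-1})$ we have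
  $f(n_1, \dots, n_k) = f(n_1, \dots, n_{k-1}) \gcd(L, n_k)$. Writing $n_k = d m$ with $d = \gcd(L, n_k)$,
  the sum of $\gcd(L, n_k)\, \tau(\mathrm{lcm}(L, n_k))^j$ over $n_k \le x$ is at most
  $\tau(L)^{j+1} x (1 + \log x)^{2^j - 1}$. Removing the variables one at a time, $j$ runs through
  $0, \dots, k - 1$ and the exponents $2^j - 1$ add up to $2^k - k - 1$.

  Lower bound: multiplying every $n_i \le y = x^{c}$ by a prime $p_i \in (y, x / n_i]$ gives distinct
  tuples without decreasing $f$, so by Chebyshev's bound the sum is at least a constant times
  $(x / \log x)^k \sum_{n_i \le y} 1 / \mathrm{lcm}(n)$. This sum of reciprocals is at least
  $(1 + \log y)^{-1} \sum_{m \le y} \tau(m)^k / m$, which has order $\log^{2^k - 1} x$.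
\<close>

text \<open>Form shared by the counting arguments below: a substitution only has to be injective
  with values in \<open>B\<close>, since nonnegativity of \<open>h\<close> covers the part of
  \<open>B\<close> that \<open>g\<close> misses.\<close>

lemma sum_le_of_inj:
  fixes f :: "'a \<Rightarrow> real" and h :: "'b \<Rightarrow> real"
  assumes "finite B" "inj_on g A" "\<And>a. a \<in> A \<Longrightarrow> g a \<in> B"
    and le: "\<And>a. a \<in> A \<Longrightarrow> f a \<le> h (g a)" and nn: "\<And>b. b \<in> B \<Longrightarrow> 0 \<le> h b"
  shows "sum f A \<le> sum h B"
proof -
  have "sum f A \<le> (\<Sum>a\<in>A. h (g a))" by (rule sum_mono) (rule le)
  also have "\<dots> = sum h (g ` A)" using assms(2) by (simp add: sum.reindex)
  also have "\<dots> \<le> sum h B" using assms by (intro sum_mono2) auto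
  finally show ?thesis .
qed

subsection \<open>The divisor function\<close>

definition divisor_count :: "nat \<Rightarrow> nat" where
  "divisor_count n = card {d. d dvd n}"

lemma divisor_count_Suc_0 [simp]: "divisor_count (Suc 0) = 1"
  by (simp add: divisor_count_def)

text \<open>Every divisor of a product splits into a divisor of each factor, so multiplication maps
  pairs of divisors onto the divisors of \<open>m * n\<close>.\<close>

lemma divisor_count_mult_le:
  assumes "m > 0" "n > 0"
  shows "divisor_count (m * n) \<le> divisor_count m * divisor_count n"
proof -
  have "{d. d dvd m * n} \<subseteq> (\<lambda>(a, b). a * b) ` ({d. d dvd m} \<times> {d. d dvd n})"
    by (auto dest!: division_decomp)
  moreover have "finite ({d. d dvd m} \<times> {d. d dvd n})"
    using assms by simp
  ultimately have "card {d. d dvd m * n} \<le> card ({d. d dvd m} \<times> {d. d dvd n})"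
    by (meson card_image_le card_mono finite_imageI le_trans)
  thus ?thesis by (simp add: divisor_count_def card_cartesian_product)
qed

text \<open>For coprime \<open>m\<close> and \<open>n\<close> multiplication of divisors is
  injective: in \<open>a * b = c * d\<close> the coprime pairs \<open>a\<close>, \<open>d\<close>
  and \<open>b\<close>, \<open>c\<close> force \<open>a = c\<close> and
  \<open>b = d\<close>.\<close>

lemma divisor_count_mult_coprime_ge:
  assumes "m > 0" "n > 0" "coprime m n"
  shows "divisor_count m * divisor_count n \<le> divisor_count (m * n)"
proof -
  have "inj_on (\<lambda>(a, b). a * b) ({d. d dvd m} \<times> {d. d dvd n})"
  proof (rule inj_onI, clarsimp)
    fix a b c d assume *: "a dvd m" "b dvd n" "c dvd m" "d dvd n" "a * b = c * d"
    have "coprime a d" "coprime b c"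
      using * assms(3) by (meson coprime_divisors coprime_commute)+
    with * show "a = c \<and> b = d"
      using coprime_crossproduct_nat[of a d c b] by (simp add: coprime_commute)
  qed
  moreover have "(\<lambda>(a, b). a * b) ` ({d. d dvd m} \<times> {d. d dvd n}) \<subseteq> {d. d dvd m * n}"
    by (auto intro: mult_dvd_mono)
  ultimately have "card ({d. d dvd m} \<times> {d. d dvd n}) \<le> card {d. d dvd m * n}"
    using assms by (intro card_inj_on_le) auto
  thus ?thesis by (simp add: divisor_count_def card_cartesian_product)
qed

lemma divisor_count_pow_mult_le:
  assumes "m > 0" "n > 0"
  shows "real (divisor_count (m * n)) ^ j \<le> real (divisor_count m) ^ j * real (divisor_count n) ^ j"
  using divisor_count_mult_le[OF assms]
  by (metis of_nat_0_le_iff of_nat_le_iff of_nat_mult power_mono power_mult_distrib)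

text \<open>Opens up a Dirichlet convolution: the pair of \<open>m\<close> and its divisor
  \<open>a\<close> becomes the factorization \<open>m = a * b\<close>, and \<open>m <= y\<close>
  turns into \<open>b <= y div a\<close>.\<close>

lemma sum_divisors_reindex_le:
  fixes F :: "nat \<Rightarrow> nat \<Rightarrow> real"
  assumes "\<And>a b. 0 \<le> F a b"
  shows "(\<Sum>m\<in>{1..y}. \<Sum>a | a dvd m. F a (m div a)) \<le> (\<Sum>a\<in>{1..y}. \<Sum>b\<in>{1..y div a}. F a b)"
proof -
  have "(\<Sum>m\<in>{1..y}. \<Sum>a | a dvd m. F a (m div a))
      = (\<Sum>(m, a)\<in>(SIGMA m:{1..y}. {a. a dvd m}). F a (m div a))"
    by (subst sum.Sigma) auto
  also have "\<dots> \<le> (\<Sum>(a, b)\<in>(SIGMA a:{1..y}. {1..y div a}). F a b)"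
  proof (rule sum_le_of_inj[where g = "\<lambda>(m, a). (a, m div a)"])
    show "inj_on (\<lambda>(m, a). (a, m div a)) (SIGMA m:{1..y}. {a. a dvd m})"
      by (auto simp: inj_on_def)
    fix p assume "p \<in> (SIGMA m:{1..y}. {a. a dvd m})"
    then obtain m a where p: "p = (m, a)" "m > 0" "m \<le> y" "a dvd m" by auto
    then have "a > 0" "a \<le> m" by (auto intro!: Nat.gr0I dest: dvd_imp_le)
    thus "(case p of (m, a) \<Rightarrow> (a, m div a)) \<in> (SIGMA a:{1..y}. {1..y div a})"
      using p by (auto simp: div_le_mono Suc_le_eq div_greater_zero_iff)
  qed (use assms in auto)
  also have "\<dots> = (\<Sum>a\<in>{1..y}. \<Sum>b\<in>{1..y div a}. F a b)"
    by (subst sum.Sigma) auto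
  finally show ?thesis .
qed

text \<open>One factor tau(m) is written as the sum of 1 over the divisors \<open>a\<close>;
  submultiplicativity along m = a * (m / a) distributes the other \<open>j\<close> factors.\<close>

lemma divisor_count_pow_Suc_le:
  assumes "m > 0"
  shows "real (divisor_count m) ^ Suc j
      \<le> (\<Sum>a | a dvd m. real (divisor_count a) ^ j * real (divisor_count (m div a)) ^ j)"
proof -
  have "real (divisor_count m) ^ Suc j = (\<Sum>a | a dvd m. real (divisor_count m) ^ j)"
    by (simp add: divisor_count_def)
  also have "\<dots> \<le> (\<Sum>a | a dvd m. real (divisor_count a) ^ j * real (divisor_count (m div a)) ^ j)"
  proof (rule sum_mono)
    fix a assume "a \<in> {a. a dvd m}"
    then have "a dvd m" by simp
    with assms show "real (divisor_count m) ^ j \<le> real (divisor_count a) ^ j * real (divisor_count (m div a)) ^ j"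
      using divisor_count_pow_mult_le[of a "m div a" j]
      by (metis dvd_div_eq_0_iff dvd_mult_div_cancel dvd_0_left gr0I)
  qed
  finally show ?thesis .
qed

text \<open>The convolution bound gives a sum over a * b <= y; enlarging it to all a, b <= y makes
  it a perfect square. The exponent \<open>s\<close> serves two later uses: \<open>s = 1\<close>
  yields powers of the logarithm, \<open>s = 2\<close> a bound independent of
  \<open>y\<close>.\<close>

lemma sum_divisor_count_pow_div_Suc_le:
  "(\<Sum>m\<in>{1..y}. real (divisor_count m) ^ Suc j / real m ^ s)
     \<le> (\<Sum>m\<in>{1..y}. real (divisor_count m) ^ j / real m ^ s)\<^sup>2"
proof -
  define h where "h m = real (divisor_count m) ^ j / real m ^ s" for m
  have h0: "h m \<ge> 0" for m by (simp add: h_def)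
  have "(\<Sum>m\<in>{1..y}. real (divisor_count m) ^ Suc j / real m ^ s)
      \<le> (\<Sum>m\<in>{1..y}. \<Sum>a | a dvd m. h a * h (m div a))"
  proof (rule sum_mono)
    fix m assume "m \<in> {1..y}"
    then have m: "m > 0" by simp
    have "real (divisor_count m) ^ Suc j / real m ^ s
        \<le> (\<Sum>a | a dvd m. real (divisor_count a) ^ j * real (divisor_count (m div a)) ^ j) / real m ^ s"
      using divisor_count_pow_Suc_le[OF m] by (intro divide_right_mono) auto
    also have "\<dots> = (\<Sum>a | a dvd m. h a * h (m div a))"
      unfolding sum_divide_distrib
    proof (rule sum.cong)
      fix a assume "a \<in> {a. a dvd m}"
      then have "real m = real a * real (m div a)"
        by (metis dvd_mult_div_cancel mem_Collect_eq of_nat_mult)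
      thus "real (divisor_count a) ^ j * real (divisor_count (m div a)) ^ j / real m ^ s = h a * h (m div a)"
        unfolding h_def by (simp add: power_mult_distrib)
    qed simp
    finally show "real (divisor_count m) ^ Suc j / real m ^ s \<le> (\<Sum>a | a dvd m. h a * h (m div a))" .
  qed
  also have "\<dots> \<le> (\<Sum>a\<in>{1..y}. \<Sum>b\<in>{1..y div a}. h a * h b)"
    by (rule sum_divisors_reindex_le) (simp add: h0)
  also have "\<dots> \<le> (\<Sum>a\<in>{1..y}. \<Sum>b\<in>{1..y}. h a * h b)"
    by (intro sum_mono sum_mono2) (auto simp: h0 intro: order_trans[OF _ div_le_dividend])
  also have "\<dots> = (\<Sum>m\<in>{1..y}. h m)\<^sup>2"
    by (simp add: power2_eq_square sum_product)
  finally show ?thesis by (simp add: h_def)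
qed

lemma sum_divisor_count_pow_div_le:
  "(\<Sum>m\<in>{1..y}. real (divisor_count m) ^ j / real m ^ s) \<le> (\<Sum>m\<in>{1..y}. 1 / real m ^ s) ^ (2 ^ j)"
proof (induction j)
  case (Suc j)
  have "(\<Sum>m\<in>{1..y}. real (divisor_count m) ^ Suc j / real m ^ s)
      \<le> (\<Sum>m\<in>{1..y}. real (divisor_count m) ^ j / real m ^ s)\<^sup>2"
    by (rule sum_divisor_count_pow_div_Suc_le)
  also have "\<dots> \<le> ((\<Sum>m\<in>{1..y}. 1 / real m ^ s) ^ (2 ^ j))\<^sup>2"
    by (intro power_mono Suc sum_nonneg) auto
  finally show ?case by (simp add: power_mult [symmetric] mult.commute)
qed simp

lemma harm_le_one_plus_ln:
  assumes "n > 0"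
  shows "harm n \<le> 1 + ln (real n)"
  using assms
proof (induction n rule: nat_induct_non_zero)
  case (Suc n)
  have "1 / (real n + 1) \<le> ln (real n + 1) - ln (real n)"
    using ln_diff_le[of "real n" "real n + 1"] Suc by simp
  moreover have "harm (Suc n) = harm n + 1 / (real n + 1)"
    by (simp add: harm_Suc inverse_eq_divide add.commute)
  ultimately show ?case using Suc by (simp add: add.commute)
qed (simp add: harm_def)

lemma sum_inverse_le_one_plus_ln:
  assumes "y \<le> x" "x > 0"
  shows "(\<Sum>m\<in>{1..y}. 1 / real m) \<le> 1 + ln (real x)"
proof -
  have "(\<Sum>m\<in>{1..y}. 1 / real m) \<le> harm x"
    unfolding harm_def using assms(1) by (simp add: sum_mono2 divide_inverse)
  also have "\<dots> \<le> 1 + ln (real x)" using assms(2) by (rule harm_le_one_plus_ln)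
  finally show ?thesis .
qed

lemma sum_inverse_squares_le: "(\<Sum>m\<in>{1..y}. 1 / real m ^ 2) \<le> 2"
proof -
  \<comment> \<open>The extra \<open>- 1 / real y\<close> makes the induction telescope. Since
    \<open>1 / 0 = 0\<close> the base case holds, but the step from 0 to 1 has to be treated
    separately.\<close>
  have "(\<Sum>m\<in>{1..y}. 1 / real m ^ 2) \<le> 2 - 1 / real y"
  proof (induction y)
    case (Suc y)
    show ?case
    proof (cases "y = 0")
      case False
      then have "1 / (real y + 1) ^ 2 \<le> 1 / real y - 1 / (real y + 1)"
        by (simp add: divide_simps power2_eq_square)
      then show ?thesis using Suc by (simp add: add.commute)
    qed simp
  qed simp
  also have "\<dots> \<le> 2" by simp
  finally show ?thesis .
qed

text \<open>In the convolution the inner sum over b <= y / a contributes \<open>2 ^ j - 1\<close>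
  logarithms by induction, and the outer sum of tau(a)^j / a contributes \<open>2 ^ j\<close> more.
  The logarithm is taken of a fixed \<open>x\<close>, so that it does not change when the range
  shrinks to \<open>y div a\<close>.\<close>

lemma sum_divisor_count_pow_le:
  assumes "x > 0" "y \<le> x"
  shows "(\<Sum>m\<in>{1..y}. real (divisor_count m) ^ j) \<le> real y * (1 + ln (real x)) ^ (2 ^ j - 1)"
  using assms(2)
proof (induction j arbitrary: y)
  case (Suc j)
  define l where "l = 1 + ln (real x)"
  have l: "l \<ge> 1" using assms(1) by (simp add: l_def)
  define t where "t m = real (divisor_count m) ^ j" for m
  have t0: "t m \<ge> 0" for m by (simp add: t_def)
  have "(\<Sum>m\<in>{1..y}. real (divisor_count m) ^ Suc j)
      \<le> (\<Sum>m\<in>{1..y}. \<Sum>a | a dvd m. t a * t (m div a))"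
    unfolding t_def by (intro sum_mono divisor_count_pow_Suc_le) auto
  also have "\<dots> \<le> (\<Sum>a\<in>{1..y}. \<Sum>b\<in>{1..y div a}. t a * t b)"
    by (rule sum_divisors_reindex_le) (simp add: t0)
  also have "\<dots> = (\<Sum>a\<in>{1..y}. t a * (\<Sum>b\<in>{1..y div a}. t b))"
    by (simp add: sum_distrib_left)
  also have "\<dots> \<le> (\<Sum>a\<in>{1..y}. t a * (real y / real a * l ^ (2 ^ j - 1)))"
  proof (intro sum_mono mult_left_mono t0)
    fix a
    have "(\<Sum>b\<in>{1..y div a}. t b) \<le> real (y div a) * l ^ (2 ^ j - 1)"
      unfolding t_def l_def
      by (rule Suc.IH) (meson Suc.prems div_le_dividend le_trans)
    also have "\<dots> \<le> real y / real a * l ^ (2 ^ j - 1)"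
      using l by (intro mult_right_mono of_nat_div_le_of_nat) auto
    finally show "(\<Sum>b\<in>{1..y div a}. t b) \<le> real y / real a * l ^ (2 ^ j - 1)" .
  qed
  also have "\<dots> = real y * l ^ (2 ^ j - 1) * (\<Sum>a\<in>{1..y}. t a / real a)"
    by (simp add: sum_distrib_left mult_ac)
  also have "\<dots> \<le> real y * l ^ (2 ^ j - 1) * l ^ (2 ^ j)"
  proof (rule mult_left_mono)
    have "(\<Sum>a\<in>{1..y}. t a / real a) \<le> (\<Sum>m\<in>{1..y}. 1 / real m) ^ (2 ^ j)"
      using sum_divisor_count_pow_div_le[of j 1 y] by (simp add: t_def)
    also have "\<dots> \<le> l ^ (2 ^ j)" unfolding l_def
      by (intro power_mono sum_inverse_le_one_plus_ln Suc.prems assms(1) sum_nonneg) auto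
    finally show "(\<Sum>a\<in>{1..y}. t a / real a) \<le> l ^ (2 ^ j)" .
  qed (use l in auto)
  also have "\<dots> = real y * l ^ (2 ^ Suc j - 1)"
    by (simp add: power_add [symmetric] mult_2)
  finally show ?case by (simp only: l_def)
qed simp

subsection \<open>Upper bound\<close>

text \<open>With a = d * m and d = gcd(L, a), the weight d cancels against the length x / d of the
  range of m. Each divisor d of \<open>L\<close> then contributes the same bound, and their number
  is the additional factor tau(L).\<close>

lemma sum_gcd_divisor_count_lcm_le:
  assumes "L > 0" "x > 0"
  shows "(\<Sum>a\<in>{1..x}. real (gcd L a) * real (divisor_count (lcm L a)) ^ j)
     \<le> real (divisor_count L) ^ Suc j * (real x * (1 + ln (real x)) ^ (2 ^ j - 1))"
proof -
  define l where "l = 1 + ln (real x)"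
  have l: "l \<ge> 1" using assms(2) by (simp add: l_def)
  define t where "t m = real (divisor_count m) ^ j" for m
  have t0: "t m \<ge> 0" for m by (simp add: t_def)
  have "(\<Sum>a\<in>{1..x}. real (gcd L a) * t (lcm L a))
     \<le> (\<Sum>(d, m)\<in>(SIGMA d:{d. d dvd L}. {1..x div d}). real d * (t L * t m))"
  \<comment> \<open>The target keeps only \<open>d dvd L\<close> and \<open>m <= x div d\<close>,
    forgetting that d is the exact gcd.\<close>
  proof (rule sum_le_of_inj[where g = "\<lambda>a. (gcd L a, a div gcd L a)"])
    show "inj_on (\<lambda>a. (gcd L a, a div gcd L a)) {1..x}"
      by (rule inj_onI) (metis dvd_mult_div_cancel gcd_dvd2 prod.inject)
    fix a assume a: "a \<in> {1..x}"
    then have g: "gcd L a > 0" "gcd L a dvd a" by auto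
    then have "0 < a div gcd L a" using a by (simp add: div_greater_zero_iff dvd_imp_le)
    then show "(gcd L a, a div gcd L a) \<in> (SIGMA d:{d. d dvd L}. {1..x div d})"
      using a by (auto simp: div_le_mono)
    have "lcm L a = L * (a div gcd L a)"
      by (simp add: lcm_nat_def div_mult_swap)
    with \<open>0 < a div gcd L a\<close> have "t (lcm L a) \<le> t L * t (a div gcd L a)"
      unfolding t_def using divisor_count_pow_mult_le[OF assms(1)] by simp
    then show "real (gcd L a) * t (lcm L a)
        \<le> (case (gcd L a, a div gcd L a) of (d, m) \<Rightarrow> real d * (t L * t m))"
      by (simp add: mult_left_mono)
  qed (use assms t0 in auto)
  also have "\<dots> = (\<Sum>d | d dvd L. t L * (real d * (\<Sum>m\<in>{1..x div d}. t m)))"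
    using assms by (subst sum.Sigma [symmetric]) (auto simp: sum_distrib_left mult_ac)
  also have "\<dots> \<le> (\<Sum>d | d dvd L. t L * (real x * l ^ (2 ^ j - 1)))"
  proof (intro sum_mono mult_left_mono t0)
    fix d
    have "real d * (\<Sum>m\<in>{1..x div d}. t m) \<le> real d * (real (x div d) * l ^ (2 ^ j - 1))"
      unfolding t_def l_def by (intro mult_left_mono sum_divisor_count_pow_le assms) auto
    also have "\<dots> = real (d * (x div d)) * l ^ (2 ^ j - 1)" by simp
    also have "\<dots> \<le> real x * l ^ (2 ^ j - 1)"
      using l by (intro mult_right_mono) (simp_all only: of_nat_le_iff times_div_less_eq_dividend, auto)
    finally show "real d * (\<Sum>m\<in>{1..x div d}. t m) \<le> real x * l ^ (2 ^ j - 1)" .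
  qed
  also have "\<dots> = real (divisor_count L) ^ Suc j * (real x * l ^ (2 ^ j - 1))"
    by (simp add: t_def divisor_count_def)
  finally show ?thesis by (simp add: t_def l_def)
qed

lemma sum_PiE_insert:
  fixes F :: "('a \<Rightarrow> 'b) \<Rightarrow> 'c :: comm_monoid_add"
  assumes "a \<notin> S"
  shows "(\<Sum>g\<in>PiE (insert a S) T. F g) = (\<Sum>g\<in>PiE S T. \<Sum>y\<in>T a. F (g(a := y)))"
proof -
  have "(\<Sum>g\<in>PiE (insert a S) T. F g) = (\<Sum>(y, g)\<in>T a \<times> PiE S T. F (g(a := y)))"
    unfolding PiE_insert_eq
    by (subst sum.reindex[OF inj_combinator[OF assms]]) (simp add: case_prod_unfold)
  also have "\<dots> = (\<Sum>y\<in>T a. \<Sum>g\<in>PiE S T. F (g(a := y)))"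
    by (simp add: sum.cartesian_product)
  also have "\<dots> = (\<Sum>g\<in>PiE S T. \<Sum>y\<in>T a. F (g(a := y)))"
    by (rule sum.swap)
  finally show ?thesis .
qed

lemma LCM_pos_nat:
  fixes n :: "nat \<Rightarrow> nat"
  assumes "\<And>i. i \<in> {1..k} \<Longrightarrow> n i > 0"
  shows "(LCM i\<in>{1..k}. n i) > 0"
  using assms by (intro Nat.gr0I) (fastforce simp: Lcm_0_iff)

lemma atLeastAtMost_1_Suc: "{1..Suc k} = insert (Suc k) {1..k}"
  by auto

text \<open>Follows from lcm(L, n) * gcd(L, n) = L * n, where L is the lcm of the first
  \<open>k\<close> entries.\<close>

lemma prod_over_lcm_Suc:
  assumes "\<And>i. i \<in> {1..Suc k} \<Longrightarrow> n i > 0"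
  shows "prod_over_lcm (Suc k) n = prod_over_lcm k n * real (gcd (LCM i\<in>{1..k}. n i) (n (Suc k)))"
proof -
  define L where "L = (LCM i\<in>{1..k}. n i)"
  have L: "L > 0" unfolding L_def using assms by (intro LCM_pos_nat) auto
  have "real (lcm L (n (Suc k))) * real (gcd L (n (Suc k))) = real L * real (n (Suc k))"
    by (metis mult.commute of_nat_mult prod_gcd_lcm_nat)
  moreover have "lcm L (n (Suc k)) > 0" using L assms[of "Suc k"] by (simp add: lcm_pos_nat)
  ultimately have G: "real L * real (n (Suc k)) / real (lcm L (n (Suc k))) = real (gcd L (n (Suc k)))"
    by (metis mult.commute nonzero_eq_divide_eq of_nat_0_less_iff less_irrefl)
  have "prod_over_lcm (Suc k) n
      = real (n (Suc k) * (\<Prod>i\<in>{1..k}. n i)) / real (lcm (n (Suc k)) L)"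
    unfolding prod_over_lcm_def atLeastAtMost_1_Suc image_insert Lcm_insert L_def [symmetric]
    by (subst prod.insert) auto
  moreover have "prod_over_lcm k n = real (\<Prod>i\<in>{1..k}. n i) / real L"
    by (simp only: prod_over_lcm_def L_def)
  ultimately show ?thesis using L
    by (simp only: L_def [symmetric] lcm.commute of_nat_mult G [symmetric]) simp
qed

text \<open>The weight $\tau(\mathrm{lcm})^j$ is what makes the induction on $k$ work: summing over the last
  variable turns $j$ into $j + 1$.\<close>

lemma sum_prod_over_lcm_divisor_count_le:
  assumes "x > 0"
  shows "(\<Sum>n\<in>{1..k} \<rightarrow>\<^sub>E {1..x}. prod_over_lcm k n * real (divisor_count (LCM i\<in>{1..k}. n i)) ^ j)
     \<le> real x ^ k * (1 + ln (real x)) ^ (\<Sum>i<k. 2 ^ (j + i) - 1)"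
proof (induction k arbitrary: j)
  case 0
  show ?case by (simp add: prod_over_lcm_def)
next
  case (Suc k)
  define l where "l = 1 + ln (real x)"
  have l: "l \<ge> 1" using assms by (simp add: l_def)
  define P where "P = ({1..k} \<rightarrow>\<^sub>E {1..x})"
  define L where "L n = (LCM i\<in>{1..k}. n i)" for n :: "nat \<Rightarrow> nat"
  define t where "t m = real (divisor_count m)" for m
  have "(\<Sum>n\<in>{1..Suc k} \<rightarrow>\<^sub>E {1..x}. prod_over_lcm (Suc k) n * t (LCM i\<in>{1..Suc k}. n i) ^ j)
      = (\<Sum>n\<in>P. \<Sum>a\<in>{1..x}. prod_over_lcm k n * (real (gcd (L n) a) * t (lcm (L n) a) ^ j))"
    unfolding P_def atLeastAtMost_1_Suc[of k]
  proof (subst sum_PiE_insert, simp, intro sum.cong refl)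
    fix n a assume n: "n \<in> {1..k} \<rightarrow>\<^sub>E {1..x}" and a: "a \<in> {1..x}"
    let ?n = "n(Suc k := a)"
    have "prod_over_lcm (Suc k) ?n = prod_over_lcm k ?n * real (gcd (LCM i\<in>{1..k}. ?n i) (?n (Suc k)))"
      using n a by (intro prod_over_lcm_Suc) (auto simp: PiE_iff Suc_le_eq)
    moreover have *: "(LCM i\<in>{1..k}. ?n i) = L n"
      unfolding L_def by (intro arg_cong[where f = Lcm] image_cong) auto
    moreover have "(LCM i\<in>insert (Suc k) {1..k}. ?n i) = lcm (L n) a"
      unfolding image_insert Lcm_insert * by (simp add: lcm.commute)
    moreover have "prod_over_lcm k ?n = prod_over_lcm k n"
      unfolding prod_over_lcm_def
      by (intro arg_cong2[where f = "(/)"] arg_cong[where f = real] arg_cong[where f = Lcm] prod.cong image_cong) auto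
    ultimately show "prod_over_lcm (Suc k) ?n * t (LCM i\<in>insert (Suc k) {1..k}. ?n i) ^ j
        = prod_over_lcm k n * (real (gcd (L n) a) * t (lcm (L n) a) ^ j)"
      by (simp only: fun_upd_same mult.assoc)
  qed
  also have "\<dots> = (\<Sum>n\<in>P. prod_over_lcm k n * (\<Sum>a\<in>{1..x}. real (gcd (L n) a) * t (lcm (L n) a) ^ j))"
    by (simp add: sum_distrib_left)
  also have "\<dots> \<le> (\<Sum>n\<in>P. prod_over_lcm k n * (t (L n) ^ Suc j * (real x * l ^ (2 ^ j - 1))))"
  proof (intro sum_mono mult_left_mono)
    fix n assume "n \<in> P"
    then have "L n > 0" unfolding L_def P_def by (intro LCM_pos_nat) (auto simp: PiE_iff Suc_le_eq)
    then show "(\<Sum>a\<in>{1..x}. real (gcd (L n) a) * t (lcm (L n) a) ^ j)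
        \<le> t (L n) ^ Suc j * (real x * l ^ (2 ^ j - 1))"
      unfolding t_def l_def by (rule sum_gcd_divisor_count_lcm_le[OF _ assms])
  qed (simp add: prod_over_lcm_def prod_nonneg)
  also have "\<dots> = (\<Sum>n\<in>P. prod_over_lcm k n * t (L n) ^ Suc j) * (real x * l ^ (2 ^ j - 1))"
    by (simp only: sum_distrib_right mult.assoc)
  also have "\<dots> \<le> (real x ^ k * l ^ (\<Sum>i<k. 2 ^ (Suc j + i) - 1)) * (real x * l ^ (2 ^ j - 1))"
    using Suc[of "Suc j"] l unfolding t_def l_def L_def P_def by (intro mult_right_mono) auto
  also have "\<dots> = real x ^ Suc k * l ^ ((2 ^ j - 1) + (\<Sum>i<k. 2 ^ (Suc j + i) - 1))"
    by (simp only: power_add power_Suc mult_ac)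
  \<comment> \<open>The exponent from the removed variable is the term \<open>i = 0\<close>; the
    induction hypothesis at \<open>Suc j\<close> supplies the shifted remaining terms.\<close>
  also have "(2 ^ j - 1) + (\<Sum>i<k. 2 ^ (Suc j + i) - 1) = (\<Sum>i<Suc k. 2 ^ (j + i) - 1 :: nat)"
    by (subst sum.lessThan_Suc_shift) simp
  finally show ?case by (simp only: l_def t_def)
qed

lemma sum_prod_over_lcm_le:
  assumes "x > 0"
  shows "(\<Sum>n\<in>{1..k} \<rightarrow>\<^sub>E {1..x}. prod_over_lcm k n) \<le> real x ^ k * (1 + ln (real x)) ^ (2 ^ k - k - 1)"
proof -
  \<comment> \<open>Stated additively, so that the truncated subtraction in
    \<open>2 ^ k - k - 1\<close> does not enter the induction.\<close>
  have "(\<Sum>i<k. 2 ^ i - 1 :: nat) + k + 1 = 2 ^ k"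
    by (induction k) auto
  then have "(\<Sum>i<k. 2 ^ i - 1 :: nat) = 2 ^ k - k - 1" by simp
  with sum_prod_over_lcm_divisor_count_le[OF assms, of k 0] show ?thesis by simp
qed

subsection \<open>Reciprocal sums\<close>

text \<open>Splitting off the gcd of a pair costs only the convergent factor
  $\sum_g \tau(g)^{2j}/g^2$; on coprime pairs the divisor function is multiplicative.\<close>

lemma sum_divisor_count_pow_div_sq_le:
  defines "h \<equiv> \<lambda>j m. real (divisor_count m) ^ j / real m"
  shows "(\<Sum>m\<in>{1..y}. h j m)\<^sup>2 \<le> 2 ^ (2 ^ (2 * j)) * (\<Sum>m\<in>{1..y\<^sup>2}. h (Suc j) m)"
proof -
  define Q where "Q = {(a, b) \<in> {1..y} \<times> {1..y}. coprime a b}"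
  define G where "G g = real (divisor_count g) ^ (2 * j) / real g ^ 2" for g
  have finQ: "finite Q" unfolding Q_def by (rule finite_subset[of _ "{1..y} \<times> {1..y}"]) auto
  have h0: "h j m \<ge> 0" for j m by (simp add: h_def)
  have G0: "G g \<ge> 0" for g by (simp add: G_def)
  have h_mult: "h j (g * a) \<le> real (divisor_count g) ^ j / real g * h j a" if "g > 0" "a > 0" for g a
    using divide_right_mono[OF divisor_count_pow_mult_le[OF that, of j], of "real (g * a)"]
    by (simp add: h_def)
  have "(\<Sum>m\<in>{1..y}. h j m)\<^sup>2 = (\<Sum>(a, b)\<in>{1..y} \<times> {1..y}. h j a * h j b)"
    by (simp add: power2_eq_square sum_product sum.cartesian_product)
  also have "\<dots> \<le> (\<Sum>(g, p)\<in>{1..y} \<times> Q. G g * (h j (fst p) * h j (snd p)))"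
  \<comment> \<open>A pair is recovered from its gcd and the two coprime cofactors. The gcd occurs
    in both entries, hence the square of its weight in \<open>G\<close>.\<close>
  proof (rule sum_le_of_inj[where g = "\<lambda>(a, b). (gcd a b, a div gcd a b, b div gcd a b)"])
    show "inj_on (\<lambda>(a, b). (gcd a b, a div gcd a b, b div gcd a b)) ({1..y} \<times> {1..y})"
      by (rule inj_onI, clarify) (metis dvd_mult_div_cancel gcd_dvd1 gcd_dvd2)
    fix p assume "p \<in> {1..y} \<times> {1..y}"
    then obtain a b where p: "p = (a, b)" "0 < a" "a \<le> y" "0 < b" "b \<le> y" by auto
    define g where "g = gcd a b"
    have g: "g > 0" "g dvd a" "g dvd b" using p by (auto simp: g_def)
    then obtain a' b' where ab: "a = g * a'" "b = g * b'" by (auto elim!: dvdE)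
    have a': "a' > 0" "b' > 0" using p ab by auto
    have "coprime a' b'"
      using p ab g div_gcd_coprime[of a b] unfolding g_def [symmetric] by simp
    moreover have "a' \<le> a" "b' \<le> b" "g \<le> a" using ab g a' by auto
    then have "a' \<le> y" "b' \<le> y" "g \<le> y" using p by linarith+
    ultimately show "(case p of (a, b) \<Rightarrow> (gcd a b, a div gcd a b, b div gcd a b)) \<in> {1..y} \<times> Q"
      using p g a' unfolding p prod.case g_def [symmetric] by (auto simp: ab Q_def)
    have "h j a * h j b \<le> (real (divisor_count g) ^ j / real g * h j a') * (real (divisor_count g) ^ j / real g * h j b')"
      unfolding ab using g a' by (intro mult_mono h_mult) (auto simp: h0)
    also have "\<dots> = G g * (h j a' * h j b')"
      by (simp add: G_def power2_eq_square mult_2 power_add)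
    finally show "(case p of (a, b) \<Rightarrow> h j a * h j b)
        \<le> (case case p of (a, b) \<Rightarrow> (gcd a b, a div gcd a b, b div gcd a b) of
              (g, p) \<Rightarrow> G g * (h j (fst p) * h j (snd p)))"
      unfolding p prod.case g_def [symmetric] using g by (simp add: ab)
  qed (use finQ h0 G0 in auto)
  also have "\<dots> = (\<Sum>g\<in>{1..y}. G g) * (\<Sum>p\<in>Q. h j (fst p) * h j (snd p))"
    by (simp add: sum_product sum.cartesian_product)
  also have "\<dots> \<le> 2 ^ (2 ^ (2 * j)) * (\<Sum>m\<in>{1..y\<^sup>2}. h (Suc j) m)"
  proof (rule mult_mono)
    have "(\<Sum>g\<in>{1..y}. G g) \<le> (\<Sum>m\<in>{1..y}. 1 / real m ^ 2) ^ (2 ^ (2 * j))"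
      unfolding G_def by (rule sum_divisor_count_pow_div_le)
    also have "\<dots> \<le> 2 ^ (2 ^ (2 * j))"
      by (intro power_mono sum_inverse_squares_le sum_nonneg) auto
    finally show "(\<Sum>g\<in>{1..y}. G g) \<le> 2 ^ (2 ^ (2 * j))" .
    have "(\<Sum>p\<in>Q. h j (fst p) * h j (snd p)) \<le> (\<Sum>(n, a)\<in>(SIGMA n:{1..y\<^sup>2}. {a. a dvd n}). h j n)"
    \<comment> \<open>A coprime pair is recorded as its product n with a chosen divisor a. Counting
      all divisors of n gives one more factor tau(n), which raises \<open>j\<close> to
      \<open>Suc j\<close>.\<close>
    proof (rule sum_le_of_inj[where g = "\<lambda>(a, b). (a * b, a)"])
      show "inj_on (\<lambda>(a, b). (a * b, a)) Q" by (auto simp: inj_on_def Q_def)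
      fix p assume "p \<in> Q"
      then obtain a b where p: "p = (a, b)" "0 < a" "a \<le> y" "0 < b" "b \<le> y" "coprime a b"
        by (auto simp: Q_def)
      have "a * b \<le> y\<^sup>2" using p by (simp add: power2_eq_square mult_mono)
      then show "(case p of (a, b) \<Rightarrow> (a * b, a)) \<in> (SIGMA n:{1..y\<^sup>2}. {a. a dvd n})"
        using p by simp
      have "(real (divisor_count a) * real (divisor_count b)) ^ j \<le> real (divisor_count (a * b)) ^ j"
        using divisor_count_mult_coprime_ge[OF p(2) p(4) p(6)]
        by (intro power_mono) (simp_all flip: of_nat_mult)
      then show "h j (fst p) * h j (snd p) \<le> (case case p of (a, b) \<Rightarrow> (a * b, a) of (n, a) \<Rightarrow> h j n)"
        by (simp add: p h_def power_mult_distrib divide_right_mono)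
    qed (auto simp: h0)
    also have "\<dots> = (\<Sum>m\<in>{1..y\<^sup>2}. h (Suc j) m)"
      by (subst sum.Sigma [symmetric]) (auto simp: h_def divisor_count_def)
    finally show "(\<Sum>p\<in>Q. h j (fst p) * h j (snd p)) \<le> (\<Sum>m\<in>{1..y\<^sup>2}. h (Suc j) m)" .
  qed (auto intro!: sum_nonneg simp: h0)
  finally show ?thesis .
qed

text \<open>Iterates the preceding inequality from the harmonic sum. Each squaring of the sum also
  squares the cutoff, which is why the range ends at \<open>y ^ (2 ^ j)\<close>.\<close>

lemma sum_divisor_count_pow_div_ge:
  "\<exists>c>0. \<forall>y>0. c * ln (real y) ^ (2 ^ j) \<le> (\<Sum>m\<in>{1..y ^ (2 ^ j)}. real (divisor_count m) ^ j / real m)"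
proof (induction j)
  case 0
  have "ln (real y) \<le> (\<Sum>m\<in>{1..y}. 1 / real m)" if "y > 0" for y
  proof -
    have "ln (real y) \<le> ln (real y + 1)" using that by simp
    also have "\<dots> \<le> harm y" by (rule ln_le_harm)
    finally show ?thesis by (simp add: harm_def divide_inverse)
  qed
  then show ?case by (intro exI[of _ 1]) auto
next
  case (Suc j)
  then obtain c where c: "c > 0"
    "\<And>y. y > 0 \<Longrightarrow> c * ln (real y) ^ (2 ^ j) \<le> (\<Sum>m\<in>{1..y ^ (2 ^ j)}. real (divisor_count m) ^ j / real m)"
    by blast
  show ?case
  proof (intro exI[of _ "c\<^sup>2 / 2 ^ (2 ^ (2 * j))"] conjI allI impI)
    fix y :: nat assume y: "y > 0"
    have "(c * ln (real y) ^ (2 ^ j))\<^sup>2 \<le> (\<Sum>m\<in>{1..y ^ (2 ^ j)}. real (divisor_count m) ^ j / real m)\<^sup>2"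
      using c y by (intro power_mono) (auto intro!: mult_nonneg_nonneg zero_le_power)
    also have "\<dots> \<le> 2 ^ (2 ^ (2 * j)) * (\<Sum>m\<in>{1..(y ^ (2 ^ j))\<^sup>2}. real (divisor_count m) ^ Suc j / real m)"
      by (rule sum_divisor_count_pow_div_sq_le)
    also have "(y ^ (2 ^ j))\<^sup>2 = y ^ (2 ^ Suc j)"
      by (simp add: power_mult [symmetric] mult.commute)
    also have "(c * ln (real y) ^ (2 ^ j))\<^sup>2 = c\<^sup>2 * ln (real y) ^ (2 ^ Suc j)"
      by (simp add: power_mult_distrib power_mult [symmetric] mult.commute)
    finally show "c\<^sup>2 / 2 ^ (2 ^ (2 * j)) * ln (real y) ^ (2 ^ Suc j)
        \<le> (\<Sum>m\<in>{1..y ^ (2 ^ Suc j)}. real (divisor_count m) ^ Suc j / real m)"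
      by (simp add: divide_simps mult.commute)
  qed (use c in simp)
qed

text \<open>The term $\tau(m)^k$ counts the $k$-tuples whose lcm divides $m$.\<close>

lemma sum_divisor_count_pow_div_le_sum_inverse_lcm:
  assumes "y > 0"
  shows "(\<Sum>m\<in>{1..y}. real (divisor_count m) ^ k / real m)
     \<le> (1 + ln (real y)) * (\<Sum>n\<in>{1..k} \<rightarrow>\<^sub>E {1..y}. 1 / real (LCM i\<in>{1..k}. n i))"
proof -
  define L where "L n = (LCM i\<in>{1..k}. n i)" for n :: "nat \<Rightarrow> nat"
  define S where "S = (SIGMA m:{1..y}. {1..k} \<rightarrow>\<^sub>E {d. d dvd m})"
  have L_dvd: "L n dvd m" if "n \<in> {1..k} \<rightarrow>\<^sub>E {d. d dvd m}" for n m
    unfolding L_def using that by (intro Lcm_least) (auto simp: PiE_iff)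
  have "(\<Sum>m\<in>{1..y}. real (divisor_count m) ^ k / real m)
      = (\<Sum>m\<in>{1..y}. \<Sum>n\<in>{1..k} \<rightarrow>\<^sub>E {d. d dvd m}. 1 / real m)"
    by (simp add: card_PiE divisor_count_def)
  also have "\<dots> = (\<Sum>(m, n)\<in>S. 1 / real m)"
    unfolding S_def by (subst sum.Sigma) (auto intro!: finite_PiE)
  also have "\<dots> \<le> (\<Sum>(n, d)\<in>({1..k} \<rightarrow>\<^sub>E {1..y}) \<times> {1..y}. 1 / real (L n) * (1 / real d))"
  \<comment> \<open>The cofactor m / L(n) together with n determines m. Letting it range over all of
    \<open>{1..y}\<close> costs the harmonic factor \<open>1 + ln y\<close>.\<close>
  proof (rule sum_le_of_inj[where g = "\<lambda>(m, n). (n, m div L n)"])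
    show "inj_on (\<lambda>(m, n). (n, m div L n)) S"
    proof (rule inj_onI)
      fix p q assume pq: "p \<in> S" "q \<in> S"
        and eq: "(\<lambda>(m, n). (n, m div L n)) p = (\<lambda>(m, n). (n, m div L n)) q"
      obtain m n m' n' where mn: "p = (m, n)" "q = (m', n')" by fastforce
      with eq have "n' = n" "m div L n = m' div L n" by auto
      moreover from this pq mn have "L n dvd m" "L n dvd m'"
        using L_dvd by (auto simp: S_def)
      ultimately show "p = q" unfolding mn by (metis dvd_mult_div_cancel)
    qed
    fix p assume "p \<in> S"
    then obtain m n where p: "p = (m, n)" "0 < m" "m \<le> y" "n \<in> {1..k} \<rightarrow>\<^sub>E {d. d dvd m}"
      by (auto simp: S_def)
    obtain d where d: "m = L n * d" using L_dvd[OF p(4)] by (auto elim: dvdE)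
    have "L n > 0" "d > 0" using p(2) d by auto
    then have "d \<le> m" using d by simp
    then have "d \<le> y" using p(3) by linarith
    moreover have "n \<in> {1..k} \<rightarrow>\<^sub>E {1..y}"
    proof (rule PiE_I)
      fix i assume "i \<in> {1..k}"
      then have "n i dvd m" using PiE_mem[OF p(4)] by simp
      then show "n i \<in> {1..y}"
        using p(2,3) dvd_imp_le[of "n i" m] dvd_pos_nat[of m "n i"] by (simp add: Suc_le_eq)
    qed (use PiE_arb[OF p(4)] in simp)
    ultimately show "(case p of (m, n) \<Rightarrow> (n, m div L n)) \<in> ({1..k} \<rightarrow>\<^sub>E {1..y}) \<times> {1..y}"
      using p d \<open>L n > 0\<close> \<open>d > 0\<close> by simp
    show "(case p of (m, n) \<Rightarrow> 1 / real m)
        \<le> (case case p of (m, n) \<Rightarrow> (n, m div L n) of (n, d) \<Rightarrow> 1 / real (L n) * (1 / real d))"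
      using d \<open>L n > 0\<close> by (simp add: p)
  qed (auto intro!: finite_PiE)
  also have "\<dots> = (\<Sum>n\<in>{1..k} \<rightarrow>\<^sub>E {1..y}. 1 / real (L n)) * (\<Sum>d\<in>{1..y}. 1 / real d)"
    unfolding sum_product sum.cartesian_product ..
  also have "\<dots> \<le> (\<Sum>n\<in>{1..k} \<rightarrow>\<^sub>E {1..y}. 1 / real (L n)) * (1 + ln (real y))"
    using assms by (intro mult_left_mono sum_inverse_le_one_plus_ln sum_nonneg) auto
  finally show ?thesis by (simp only: L_def mult.commute)
qed

subsection \<open>Chebyshev's lower bound for the number of primes\<close>

text \<open>The recurrence $\frac{1}{(m+1)\binom{n}{m+1}} = \frac{1}{m\binom{n-1}{m}} - \frac{1}{m\binom{n}{m}}$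
  of the Leibniz harmonic triangle shows that $m \binom{n}{m}$ divides every common multiple of
  $1, \dots, n$.\<close>

lemma leibniz_triangle_dvd:
  fixes D :: nat
  assumes "\<And>i. i \<in> {1..N} \<Longrightarrow> i dvd D" "0 < m" "m \<le> n" "n \<le> N"
  shows "real D / (real m * real (n choose m)) \<in> \<int>"
  using assms(2-)
proof (induction m arbitrary: n rule: nat_induct_non_zero)
  case 1
  then have "n dvd D" using assms(1) by simp
  then obtain q where "D = n * q" ..
  then show ?case using 1 by simp
next
  case (Suc m)
  have A: "real D / (real m * real (n choose m)) \<in> \<int>"
    using Suc by simp
  have B: "real D / (real m * real ((n - 1) choose m)) \<in> \<int>"
    using Suc by simp
  have pos: "real (n choose m) > 0" "real ((n - 1) choose m) > 0" "real (n choose Suc m) > 0"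
    using Suc.prems by simp_all
  have e2: "real n * real ((n - 1) choose m) = real (n choose m) * (real n - real m)"
    using Suc.prems binomial_absorb_comp[of n m] by (metis Suc_leD mult.commute of_nat_diff of_nat_mult)
  have e1: "real (Suc m) * real (n choose Suc m) = real (n choose m) * (real n - real m)"
    unfolding e2 [symmetric] of_nat_mult [symmetric] by (subst binomial_absorption) simp
  have nm: "real n - real m > 0" using Suc.prems by simp
  have "real D / (real (Suc m) * real (n choose Suc m))
      = real D / (real m * real ((n - 1) choose m)) - real D / (real m * real (n choose m))"
  \<comment> \<open>Both absorption identities express the neighbouring entries through
    \<open>n choose m\<close>. The recurrence then becomes the rational identity below with
    \<open>a = n\<close>, \<open>b = m\<close> and \<open>c = n choose m\<close>.\<close>
  proof -
    have "real ((n - 1) choose m) = real (n choose m) * (real n - real m) / real n"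
      using e2 nm by (simp add: field_simps)
    moreover have "d / (c * (a - b)) = d / (b * (c * (a - b) / a)) - d / (b * c)"
      if "c > 0" "b > 0" "a - b > 0" for a b c d :: real
      using that by (simp add: divide_simps) (simp add: algebra_simps)
    ultimately show ?thesis unfolding e1 using pos nm Suc.hyps by simp
  qed
  with A B show ?case by simp
qed

text \<open>The central entry \<open>n = 2 * N\<close>, \<open>m = N\<close> of the triangle shows
  that N * binom(2N, N) divides \<open>D\<close>; the bound binom(2N, N) >= 4^N / (2N) then cancels
  the factor N.\<close>

lemma common_multiple_lower_bound:
  fixes D :: nat
  assumes "\<And>i. i \<in> {1..2 * N} \<Longrightarrow> i dvd D" "D > 0" "N > 0"
  shows "4 ^ N / 2 \<le> real D"
proof -
  define c where "c = real N * real ((2 * N) choose N)"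
  have c: "c > 0" using assms(3) by (simp add: c_def)
  have "real D / c \<in> \<int>"
    unfolding c_def using assms by (intro leibniz_triangle_dvd[of "2 * N"]) auto
  moreover have "real D / c > 0" using c assms by simp
  ultimately have "real D / c \<ge> 1" by (auto elim!: Ints_cases)
  then have "c \<le> real D" using c by simp
  moreover have "4 ^ N / 2 \<le> c"
    using central_binomial_lower_bound[OF assms(3)] assms(3) by (simp add: c_def field_simps)
  ultimately show ?thesis by linarith
qed

text \<open>The product \<open>D\<close> of the largest prime powers up to \<open>n\<close> is a
  common multiple of 1, ..., n. Each of its factors is at most \<open>n\<close>, so \<open>D\<close>
  is at most n to the number of primes, and logarithms are compared.\<close>

lemma prime_counting_lower_bound:
  assumes "n \<ge> 2"
  shows "(real n - 2) * ln 2 \<le> real (card {p. prime p \<and> p \<le> n}) * ln (real n)"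
proof -
  define P where "P = {p. prime p \<and> p \<le> n}"
  have finP: "finite P" by (simp add: P_def)
  define e where "e p = Max {e. p ^ e \<le> n}" for p :: nat
  have fin: "finite {e. p ^ e \<le> n}" if "prime p" for p
  proof (rule finite_subset)
    show "{e. p ^ e \<le> n} \<subseteq> {..n}"
    proof clarify
      fix e assume "p ^ e \<le> n"
      moreover have "e < p ^ e" using power_gt_expt[of p e] prime_gt_1_nat[OF that] by simp
      ultimately show "e \<le> n" by simp
    qed
  qed simp
  have e: "p ^ e p \<le> n" if "prime p" for p
  proof -
    have "e p \<in> {e. p ^ e \<le> n}"
      unfolding e_def using fin[OF that] assms by (intro Max_in) (auto intro!: exI[of _ 0])
    then show ?thesis by simp
  qed
  define D where "D = (\<Prod>p\<in>P. p ^ e p)"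
  have D: "D > 0" unfolding D_def by (intro prod_pos) (auto simp: P_def prime_gt_0_nat)
  have "i dvd D" if i: "i \<in> {1..n}" for i
  proof -
    have "i = (\<Prod>p\<in>prime_factors i. p ^ multiplicity p i)"
      using i by (subst prod_prime_factors) auto
    also have "\<dots> dvd D"
      unfolding D_def
    proof (rule prod_dvd_prod_subset2[OF finP])
      show "prime_factors i \<subseteq> P"
        using i by (auto simp: P_def in_prime_factors_iff dest!: dvd_imp_le)
      fix p assume p: "p \<in> prime_factors i"
      then have "p ^ multiplicity p i \<le> n"
        using i by (intro order_trans[OF dvd_imp_le[OF multiplicity_dvd]]) auto
      then have "multiplicity p i \<le> e p"
        unfolding e_def using p fin by (intro Max_ge) auto
      then show "p ^ multiplicity p i dvd p ^ e p" by (rule le_imp_power_dvd)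
    qed
    finally show ?thesis .
  qed
  then have "4 ^ (n div 2) / 2 \<le> real D"
    using assms D by (intro common_multiple_lower_bound) auto
  also have "real D \<le> real n ^ card P"
  proof -
    have "D \<le> (\<Prod>p\<in>P. n)"
      unfolding D_def by (intro prod_mono) (auto simp: P_def e)
    then show ?thesis by (simp flip: of_nat_power)
  qed
  finally have "ln (4 ^ (n div 2) / 2) \<le> ln (real n ^ card P)"
    using assms by (subst ln_le_cancel_iff) auto
  also have "\<dots> = real (card P) * ln (real n)" using assms by (simp add: ln_realpow)
  finally have "ln (4 ^ (n div 2) / 2) \<le> real (card P) * ln (real n)" .
  moreover have "ln (4 ^ (n div 2) / 2 :: real) = (2 * real (n div 2) - 1) * ln 2"
  proof -
    have "ln (4 :: real) = 2 * ln 2" using ln_realpow[of 2 2] by simp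
    then show ?thesis by (simp add: ln_div ln_realpow algebra_simps)
  qed
  \<comment> \<open>Rounding in \<open>n div 2\<close> loses at most one \<open>ln 2\<close>; the
    denominator 2 has already cost another.\<close>
  moreover have "(real n - 2) * ln 2 \<le> (2 * real (n div 2) - 1) * ln 2"
  proof (rule mult_right_mono)
    have "n \<le> 2 * (n div 2) + 1" by simp
    then show "real n - 2 \<le> 2 * real (n div 2) - 1" by linarith
  qed simp
  ultimately show ?thesis unfolding P_def by linarith
qed

subsection \<open>Lower bound\<close>

text \<open>The tuples $(n_i p_i)$ with $n_i \le y < p_i$ and $p_i$ prime determine $n$ and $p$, and passing
  from $n$ to $(n_i p_i)$ does not decrease the quotient of product and lcm.\<close>

lemma sum_inverse_lcm_le_sum_prod_over_lcm:
  fixes a :: real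
  assumes a: "a \<ge> 0"
    and card_ge: "\<And>d. d \<in> {1..y} \<Longrightarrow> a / real d \<le> real (card {p. prime p \<and> y < p \<and> p \<le> x div d})"
  shows "a ^ k * (\<Sum>n\<in>{1..k} \<rightarrow>\<^sub>E {1..y}. 1 / real (LCM i\<in>{1..k}. n i))
     \<le> (\<Sum>n\<in>{1..k} \<rightarrow>\<^sub>E {1..x}. prod_over_lcm k n)"
proof -
  define Q where "Q d = {p :: nat. prime p \<and> y < p \<and> p \<le> x div d}" for d
  define P where "P = ({1..k} \<rightarrow>\<^sub>E {1..y})"
  define R where "R n = PiE {1..k} (\<lambda>i. Q (n i))" for n
  define S where "S = (SIGMA n:P. R n)"
  have finQ: "finite (Q d)" for d by (simp add: Q_def)
  have finP: "finite P" unfolding P_def by (intro finite_PiE) auto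
  have finR: "finite (R n)" for n unfolding R_def using finQ by (intro finite_PiE) auto
  \<comment> \<open>The product in the numerator of \<open>prod_over_lcm\<close> is cancelled by the
    denominators of a / n_i, each of which is a lower bound for the number of admissible primes
    p_i.\<close>
  have "a ^ k * (\<Sum>n\<in>P. 1 / real (LCM i\<in>{1..k}. n i)) = (\<Sum>n\<in>P. prod_over_lcm k n * (\<Prod>i\<in>{1..k}. a / real (n i)))"
    unfolding sum_distrib_left
  proof (rule sum.cong)
    fix n assume "n \<in> P"
    then have "(\<Prod>i\<in>{1..k}. real (n i)) \<noteq> 0" by (auto simp: P_def PiE_iff)
    then show "a ^ k * (1 / real (LCM i\<in>{1..k}. n i)) = prod_over_lcm k n * (\<Prod>i\<in>{1..k}. a / real (n i))"
      by (simp add: prod_over_lcm_def prod_dividef)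
  qed simp
  also have "\<dots> \<le> (\<Sum>n\<in>P. prod_over_lcm k n * (\<Prod>i\<in>{1..k}. real (card (Q (n i)))))"
    using a unfolding Q_def
    by (intro sum_mono mult_left_mono prod_mono conjI card_ge)
       (auto simp: P_def PiE_iff prod_over_lcm_def prod_nonneg)
  also have "\<dots> = (\<Sum>n\<in>P. \<Sum>p\<in>R n. prod_over_lcm k n)"
    by (simp add: R_def card_PiE mult.commute)
  also have "\<dots> = (\<Sum>(n, p)\<in>S. prod_over_lcm k n)"
    unfolding S_def using finP finR by (subst sum.Sigma) auto
  also have "\<dots> \<le> (\<Sum>n\<in>{1..k} \<rightarrow>\<^sub>E {1..x}. prod_over_lcm k n)"
  proof (rule sum_le_of_inj[where g = "\<lambda>(n, p). restrict (\<lambda>i. n i * p i) {1..k}"])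
    show "inj_on (\<lambda>(n, p). restrict (\<lambda>i. n i * p i) {1..k}) S"
    proof (rule inj_onI)
      fix u v assume uv: "u \<in> S" "v \<in> S"
        and eq: "(\<lambda>(n, p). restrict (\<lambda>i. n i * p i) {1..k}) u = (\<lambda>(n, p). restrict (\<lambda>i. n i * p i) {1..k}) v"
      obtain n p n' p' where u: "u = (n, p)" and v: "v = (n', p')" by fastforce
      have ext: "n \<in> P" "n' \<in> P" "p \<in> R n" "p' \<in> R n'" using uv u v by (auto simp: S_def)
      have "n i = n' i \<and> p i = p' i" if i: "i \<in> {1..k}" for i
      proof -
        have e: "n i * p i = n' i * p' i"
          using fun_cong[OF eq, of i] i u v by simp
        have n: "0 < n i" "n i \<le> y" "0 < n' i" "n' i \<le> y" using ext i by (auto simp: P_def PiE_iff Suc_le_eq)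
        have p: "prime (p i)" "prime (p' i)" "y < p i" "y < p' i"
          using ext i by (auto simp: R_def Q_def PiE_iff)
        have "p i dvd n' i * p' i" using e by (metis dvd_triv_right)
        \<comment> \<open>The prime \<open>p i\<close> exceeds \<open>y\<close> and hence the
          positive number \<open>n' i\<close>, so it cannot divide that factor.\<close>
        then have "p i dvd p' i"
          using p n by (metis dvd_imp_le leD order_less_le_trans prime_dvd_mult_iff)
        then have "p i = p' i" using p by (simp add: primes_dvd_imp_eq)
        with e p show ?thesis by auto
      qed
      then have *: "n i = n' i" "p i = p' i" if "i \<in> {1..k}" for i using that by blast+
      have "n = n'" using ext(1,2) *(1) unfolding P_def by (rule PiE_ext)
      moreover have "p = p'" using ext(3,4) *(2) unfolding R_def \<open>n = n'\<close> by (rule PiE_ext)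
      ultimately show "u = v" by (simp add: u v)
    qed
    fix u assume "u \<in> S"
    then obtain n p where u: "u = (n, p)" "n \<in> P" "p \<in> R n" by (auto simp: S_def)
    have n: "0 < n i" if "i \<in> {1..k}" for i using u that by (auto simp: P_def PiE_iff Suc_le_eq)
    have p: "0 < p i" "p i \<le> x div n i" if "i \<in> {1..k}" for i
      using u that by (auto simp: R_def Q_def PiE_iff prime_gt_0_nat)
    have "n i * p i \<le> x" if "i \<in> {1..k}" for i
      using p(2)[OF that] by (meson mult_le_mono2 order_trans times_div_less_eq_dividend)
    then show "(case u of (n, p) \<Rightarrow> restrict (\<lambda>i. n i * p i) {1..k}) \<in> {1..k} \<rightarrow>\<^sub>E {1..x}"
      using n p by (auto simp: u PiE_iff Suc_le_eq)
    define L where "L = (LCM i\<in>{1..k}. n i)"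
    define L' where "L' = (LCM i\<in>{1..k}. n i * p i)"
    define q where "q = (\<Prod>i\<in>{1..k}. p i)"
    have pos: "L > 0" "L' > 0" unfolding L_def L'_def using n p by (intro LCM_pos_nat; simp)+
    have q: "q > 0" unfolding q_def using p by (intro prod_pos) auto
    \<comment> \<open>The product of the entries grows by exactly \<open>q\<close>, the lcm by a
      factor of at most \<open>q\<close>.\<close>
    have "L' dvd L * q" unfolding L'_def L_def q_def
      by (intro Lcm_least) (auto intro!: mult_dvd_mono)
    then have "L' \<le> L * q" using pos q by (intro dvd_imp_le) auto
    then have "1 / real L \<le> real q / real L'"
      using pos by (simp add: divide_simps mult.commute flip: of_nat_mult)
    then have "real (\<Prod>i\<in>{1..k}. n i) * (1 / real L) \<le> real (\<Prod>i\<in>{1..k}. n i) * (real q / real L')"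
      by (rule mult_left_mono) (rule of_nat_0_le_iff)
    also have "\<dots> = prod_over_lcm k (restrict (\<lambda>i. n i * p i) {1..k})"
      by (simp add: prod_over_lcm_def L'_def q_def prod.distrib)
    finally show "(case u of (n, p) \<Rightarrow> prod_over_lcm k n)
        \<le> prod_over_lcm k (case u of (n, p) \<Rightarrow> restrict (\<lambda>i. n i * p i) {1..k})"
      by (simp add: u prod_over_lcm_def L_def)
  qed (simp_all add: prod_over_lcm_def prod_nonneg finite_PiE)
  finally show ?thesis by (simp only: P_def)
qed

text \<open>Chebyshev's bound is applied at z = x div d, and the at most \<open>y\<close> primes up
  to \<open>y\<close> are discarded. The threshold is uniform in \<open>y\<close> and
  \<open>d\<close>, so \<open>y\<close> may later depend on \<open>x\<close>.\<close>

lemma eventually_card_primes_ge: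
  "\<forall>\<^sub>F x in sequentially. \<forall>y d. real y \<le> real x powr (1 / 4) \<longrightarrow> d \<in> {1..y} \<longrightarrow>
     real x / (4 * ln (real x)) / real d \<le> real (card {p. prime p \<and> y < p \<and> p \<le> x div d})"
proof -
  \<comment> \<open>The constant is 5/12 = 2/3 - 1/4: Chebyshev with ln 2 >= 2/3 gives (2/3) (t - 3)
    for t = x / d >= x^(3/4), of which t / 4 is to remain. The left side collects the rounding loss
    and the discarded primes.\<close>
  have "\<forall>\<^sub>F x in sequentially. 2 + real x powr (1 / 4) * ln (real x) \<le> 5 / 12 * real x powr (3 / 4)"
    by real_asymp
  moreover have "\<forall>\<^sub>F x in sequentially. 3 \<le> real x powr (3 / 4)" by real_asymp
  moreover have "\<forall>\<^sub>F x in sequentially. (3 :: nat) \<le> x" by (rule eventually_ge_at_top)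
  ultimately show ?thesis
  proof (eventually_elim, intro allI impI)
    fix x y d :: nat
    assume E: "2 + real x powr (1 / 4) * ln (real x) \<le> 5 / 12 * real x powr (3 / 4)"
      "3 \<le> real x powr (3 / 4)" "3 \<le> x" and y: "real y \<le> real x powr (1 / 4)" and d: "d \<in> {1..y}"
    define z where "z = x div d"
    define t where "t = real x / real d"
    define Q where "Q = {p. prime p \<and> y < p \<and> p \<le> z}"
    have l: "ln (real x) > 0" using E by simp
    have "real x powr (3 / 4) * real d \<le> real x powr (3 / 4) * real x powr (1 / 4)"
      using y d by (intro mult_left_mono) auto
    also have "\<dots> = real x" using E by (simp flip: powr_add)
    finally have t: "real x powr (3 / 4) \<le> t" using d by (simp add: t_def field_simps)
    have "x < d * (z + 1)"
      unfolding z_def using d dividend_less_times_div[of d x] by simp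
    then have "real x < real d * (real z + 1)"
      by (metis of_nat_1 of_nat_add of_nat_less_iff of_nat_mult)
    then have z: "t - 1 \<le> real z"
      using d by (simp add: t_def field_simps)
    then have z2: "z \<ge> 2" using t E by linarith
    have "z \<le> x" by (simp add: z_def)
    have "card {p. prime p \<and> p \<le> z} \<le> card ({1..y} \<union> Q)"
      by (intro card_mono) (auto simp: Q_def Suc_le_eq prime_gt_0_nat)
    also have "\<dots> \<le> y + card Q" using card_Un_le[of "{1..y}" Q] by simp
    finally have c: "real (card {p. prime p \<and> p \<le> z}) \<le> real y + real (card Q)" by linarith
    have "(t - 3) * (2 / 3) \<le> (real z - 2) * ln 2"
      using z z2 ln2_ge_two_thirds t E by (intro mult_mono) auto
    also have "\<dots> \<le> real (card {p. prime p \<and> p \<le> z}) * ln (real z)"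
      using z2 by (rule prime_counting_lower_bound)
    also have "\<dots> \<le> (real y + real (card Q)) * ln (real x)"
      using c z2 \<open>z \<le> x\<close> by (intro mult_mono) auto
    also have "\<dots> \<le> (real x powr (1 / 4) + real (card Q)) * ln (real x)"
      using y l by (intro mult_right_mono) auto
    finally have "t / 4 \<le> real (card Q) * ln (real x)"
      using E t by (simp add: algebra_simps)
    then have "t / (4 * ln (real x)) \<le> real (card Q)" using l by (simp add: field_simps)
    then show "real x / (4 * ln (real x)) / real d \<le> real (card {p. prime p \<and> y < p \<and> p \<le> x div d})"
      by (simp add: t_def Q_def z_def mult.commute)
  qed
qed

lemma sum_prod_over_lcm_ge:
  "\<exists>A>0. \<forall>\<^sub>F x in sequentially.
     A * (real x ^ k * ln (real x) ^ (2 ^ k - k - 1)) \<le> (\<Sum>n\<in>{1..k} \<rightarrow>\<^sub>E {1..x}. prod_over_lcm k n)"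
proof -
  obtain c where c: "c > 0"
    "\<And>w. w > 0 \<Longrightarrow> c * ln (real w) ^ (2 ^ k) \<le> (\<Sum>m\<in>{1..w ^ (2 ^ k)}. real (divisor_count m) ^ k / real m)"
    using sum_divisor_count_pow_div_ge[of k] by blast
  \<comment> \<open>Chosen so that the cutoff y = w^(2^k) with w = floor(x^b) is at most
    x^(1/4).\<close>
  define b :: real where "b = 1 / (4 * 2 ^ k)"
  have b: "b > 0" by (simp add: b_def)
  \<comment> \<open>The powers of 1/4 come from the prime count, \<open>b / 2\<close> from ln w >=
    (b / 2) ln x, and the last 1/2 from 1 + ln y <= 2 ln x.\<close>
  define A where "A = (1 / 4) ^ k * (c * (b / 2) ^ (2 ^ k) / 2)"
  \<comment> \<open>Halving the exponent absorbs the floor in the definition of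
    \<open>w\<close>.\<close>
  have "\<forall>\<^sub>F x in sequentially. real x powr (b / 2) \<le> real x powr b - 1"
    using b by real_asymp
  then have "\<forall>\<^sub>F x in sequentially. A * (real x ^ k * ln (real x) ^ (2 ^ k - k - 1))
      \<le> (\<Sum>n\<in>{1..k} \<rightarrow>\<^sub>E {1..x}. prod_over_lcm k n)"
    using eventually_card_primes_ge eventually_ge_at_top[of 3]
  proof eventually_elim
    case (elim x)
    define l where "l = ln (real x)"
    have l: "l \<ge> 1"
    proof -
      have "exp 1 \<le> real x" using exp_le elim by linarith
      then show ?thesis unfolding l_def using elim by (subst ln_ge_iff) auto
    qed
    define w where "w = nat \<lfloor>real x powr b\<rfloor>"
    have w_ge: "real x powr (b / 2) \<le> real w" using elim unfolding w_def by linarith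
    moreover have "real x powr (b / 2) > 0" using elim by simp
    ultimately have w: "w > 0" by linarith
    have w_le: "real w \<le> real x powr b" unfolding w_def by simp
    define y where "y = w ^ (2 ^ k)"
    have y: "y > 0" using w by (simp add: y_def)
    have "real y \<le> (real x powr b) ^ (2 ^ k)"
      unfolding y_def of_nat_power using w_le by (intro power_mono) auto
    also have "\<dots> = real x powr (1 / 4)"
      using elim by (simp add: powr_powr b_def flip: powr_realpow)
    finally have y_le: "real y \<le> real x powr (1 / 4)" .
    also have "\<dots> \<le> real x powr 1" using elim by (intro powr_mono) auto
    finally have "real y \<le> real x" using elim by simp
    then have "ln (real y) \<le> l" unfolding l_def using y by simp
    then have ln_y: "1 + ln (real y) \<le> 2 * l" using l by linarith
    define T where "T = (\<Sum>n\<in>{1..k} \<rightarrow>\<^sub>E {1..y}. 1 / real (LCM i\<in>{1..k}. n i))"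
    have T0: "T \<ge> 0" unfolding T_def by (intro sum_nonneg) auto
    have "b / 2 * l = ln (real x powr (b / 2))" using elim by (simp add: l_def ln_powr)
    also have "\<dots> \<le> ln (real w)" using w_ge elim w by (subst ln_le_cancel_iff) auto
    finally have "c * (b / 2 * l) ^ (2 ^ k) \<le> c * ln (real w) ^ (2 ^ k)"
      using b l c by (intro mult_left_mono power_mono) auto
    also have "\<dots> \<le> (1 + ln (real y)) * T"
      using c(2)[OF w] sum_divisor_count_pow_div_le_sum_inverse_lcm[OF y, of k]
      unfolding y_def T_def by linarith
    also have "\<dots> \<le> 2 * l * T" using ln_y T0 by (rule mult_right_mono)
    finally have T: "c * (b / 2 * l) ^ (2 ^ k) / (2 * l) \<le> T" using l by (simp add: field_simps)
    \<comment> \<open>Of the \<open>2 ^ k\<close> logarithms, \<open>k\<close> are lost to the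
      density of the primes and one to the factor \<open>1 + ln y\<close>.\<close>
    have "2 ^ k = (2 ^ k - k - 1) + k + (1 :: nat)"
      using less_exp[of k] by linarith
    then have "l ^ (2 ^ k) = l ^ (2 ^ k - k - 1) * l ^ k * l"
      by (metis power_add power_one_right)
    then have "A * (real x ^ k * l ^ (2 ^ k - k - 1)) = (real x / (4 * l)) ^ k * (c * (b / 2 * l) ^ (2 ^ k) / (2 * l))"
      unfolding A_def power_mult_distrib power_divide using l by simp
    also have "\<dots> \<le> (real x / (4 * l)) ^ k * T"
      using T l by (intro mult_left_mono) auto
    also have "\<dots> \<le> (\<Sum>n\<in>{1..k} \<rightarrow>\<^sub>E {1..x}. prod_over_lcm k n)"
      unfolding T_def
    proof (rule sum_inverse_lcm_le_sum_prod_over_lcm)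
      show "real x / (4 * l) / real d \<le> real (card {p. prime p \<and> y < p \<and> p \<le> x div d})"
        if "d \<in> {1..y}" for d
        using elim(2) y_le that unfolding l_def by blast
    qed (use l in simp)
    finally show ?case by (simp only: l_def)
  qed
  moreover have "A > 0" using b c by (simp add: A_def)
  ultimately show ?thesis by blast
qed

subsection \<open>The expectation\<close>

text \<open>Almost surely the integrand is a finite combination of indicators of the events
  \<open>E n\<close>, and independence gives each of these probability x^(-k).\<close>

lemma expectation_prod_over_lcm:
  assumes "indep_uniform_vars M k x X" "x > 0"
  shows "prob_space.expectation M (\<lambda>\<omega>. prod_over_lcm k (\<lambda>i. X i \<omega>))
    = (\<Sum>n\<in>{1..k} \<rightarrow>\<^sub>E {1..x}. prod_over_lcm k n) / real x ^ k"
proof -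
  from assms interpret prob_space M by (simp add: indep_uniform_vars_def)
  have indep: "indep_vars (\<lambda>_. count_space UNIV) X {1..k}"
    and distr: "\<And>i. i \<in> {1..k} \<Longrightarrow> distr M (count_space UNIV) (X i) = measure_pmf (pmf_of_set {1..x})"
    using assms(1) by (auto simp: indep_uniform_vars_def)
  have X: "X i \<in> measurable M (count_space UNIV)" if "i \<in> {1..k}" for i
    using indep that by (simp add: indep_vars_def)
  define P where "P = ({1..k} \<rightarrow>\<^sub>E {1..x})"
  have finP: "finite P" unfolding P_def by (intro finite_PiE) auto
  define E where "E n = {\<omega> \<in> space M. \<forall>i\<in>{1..k}. X i \<omega> = n i}" for n
  have E_sets: "E n \<in> sets M" for n
  proof -
    show ?thesis unfolding E_def using X by measurable
  qed
  have prob_single: "prob (X i -` {a} \<inter> space M) = 1 / real x" if "i \<in> {1..k}" "a \<in> {1..x}" for i a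
  proof -
    have "prob (X i -` {a} \<inter> space M) = measure (distr M (count_space UNIV) (X i)) {a}"
      using X[OF that(1)] by (subst measure_distr) auto
    also have "\<dots> = pmf (pmf_of_set {1..x}) a"
      by (simp add: distr[OF that(1)] pmf.rep_eq)
    also have "\<dots> = 1 / real x" using that assms(2) by (subst pmf_of_set) auto
    finally show ?thesis .
  qed
  have prob_E: "prob (E n) = 1 / real x ^ k" if "n \<in> P" for n
  \<comment> \<open>The product rule for independent variables is applied to a nonempty index set;
    for \<open>k = 0\<close> the event is the whole space.\<close>
  proof (cases "k = 0")
    case True
    then show ?thesis by (simp add: E_def prob_space)
  next
    case False
    then have "E n = (\<Inter>i\<in>{1..k}. X i -` {n i} \<inter> space M)"
      by (auto simp: E_def)
    also have "prob \<dots> = (\<Prod>i\<in>{1..k}. prob (X i -` {n i} \<inter> space M))"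
      using False by (intro indep_varsD[OF indep]) auto
    also have "\<dots> = (\<Prod>i\<in>{1..k}. 1 / real x)"
      using that by (intro prod.cong prob_single) (auto simp: P_def)
    finally show ?thesis by (simp add: power_one_over)
  qed
  have "AE \<omega> in M. X i \<omega> \<in> {1..x}" if "i \<in> {1..k}" for i
  proof -
    have "AE a in distr M (count_space UNIV) (X i). a \<in> {1..x}"
      unfolding distr[OF that] using assms(2) by (simp add: AE_measure_pmf_iff)
    then show ?thesis using X[OF that] by (simp add: AE_distr_iff)
  qed
  then have AE: "AE \<omega> in M. \<forall>i\<in>{1..k}. X i \<omega> \<in> {1..x}"
    by (intro AE_finite_allI) auto
  have "AE \<omega> in M. prod_over_lcm k (\<lambda>i. X i \<omega>) = (\<Sum>n\<in>P. prod_over_lcm k n * indicator (E n) \<omega>)"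
    using AE AE_space
  proof eventually_elim
    case (elim \<omega>)
    \<comment> \<open>Restriction sets the values outside \<open>{1..k}\<close> to
      \<open>undefined\<close>, so the outcome is the unique element of \<open>P\<close> whose event
      contains it.\<close>
    define n where "n = restrict (\<lambda>i. X i \<omega>) {1..k}"
    have "n \<in> P" using elim by (auto simp: n_def P_def)
    have "(\<Sum>m\<in>P. prod_over_lcm k m * indicator (E m) \<omega>) = (\<Sum>m\<in>P. if m = n then prod_over_lcm k n else 0)"
    proof (intro sum.cong refl)
      fix m assume "m \<in> P"
      then have "\<omega> \<in> E m \<longleftrightarrow> m = n"
        using elim \<open>n \<in> P\<close> unfolding E_def P_def n_def by (auto intro!: PiE_ext simp: restrict_def)
      then show "prod_over_lcm k m * indicator (E m) \<omega> = (if m = n then prod_over_lcm k n else 0)"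
        by (auto simp: indicator_def)
    qed
    also have "\<dots> = prod_over_lcm k n" using finP \<open>n \<in> P\<close> by simp
    also have "\<dots> = prod_over_lcm k (\<lambda>i. X i \<omega>)"
      by (simp add: prod_over_lcm_def n_def)
    finally show ?case ..
  qed
  moreover have "(\<lambda>\<omega>. prod_over_lcm k (\<lambda>i. X i \<omega>)) \<in> borel_measurable M"
  proof -
    \<comment> \<open>A finite product of countable discrete spaces is discrete, so every function
      of the random tuple is measurable.\<close>
    have "(\<lambda>\<omega>. restrict (\<lambda>i. X i \<omega>) {1..k}) \<in> measurable M (PiM {1..k} (\<lambda>_. count_space UNIV))"
      by (intro measurable_restrict X)
    also have "PiM {1..k} (\<lambda>_. count_space (UNIV :: nat set)) = count_space ({1..k} \<rightarrow>\<^sub>E UNIV)"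
      by (rule count_space_PiM_finite) auto
    finally have "(\<lambda>\<omega>. prod_over_lcm k (restrict (\<lambda>i. X i \<omega>) {1..k})) \<in> borel_measurable M"
      by (rule measurable_compose) simp
    then show ?thesis by (simp add: prod_over_lcm_def)
  qed
  ultimately have "expectation (\<lambda>\<omega>. prod_over_lcm k (\<lambda>i. X i \<omega>))
      = expectation (\<lambda>\<omega>. \<Sum>n\<in>P. prod_over_lcm k n * indicator (E n) \<omega>)"
    using E_sets by (intro integral_cong_AE) auto
  also have "\<dots> = (\<Sum>n\<in>P. prod_over_lcm k n * prob (E n))"
    using E_sets by (subst Bochner_Integration.integral_sum) (auto simp: emeasure_eq_measure)
  also have "\<dots> = (\<Sum>n\<in>P. prod_over_lcm k n) / real x ^ k"
    by (simp add: prob_E sum_divide_distrib)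
  finally show ?thesis by (simp only: P_def)
qed

theorem theorem1p3:
  fixes k :: nat
  assumes "k \<ge> 2"
  shows "(\<exists>A B :: real. 0 < A \<and> A \<le> B \<and>
            (\<forall>\<^sub>F x :: nat in sequentially.
               \<forall>(M :: 'a measure) X. indep_uniform_vars M k x X \<longrightarrow>
                 A * ln (real x) ^ (2 ^ k - k - 1)
                   \<le> prob_space.expectation M (\<lambda>\<omega>. prod_over_lcm k (\<lambda>i. X i \<omega>)) \<and>
                 prob_space.expectation M (\<lambda>\<omega>. prod_over_lcm k (\<lambda>i. X i \<omega>))
                   \<le> B * ln (real x) ^ (2 ^ k - k - 1)))
       \<and> (\<lambda>x :: nat. \<Sum>n\<in>{1..k} \<rightarrow>\<^sub>E {1..x}. prod_over_lcm k n)
            \<in> \<Theta>(\<lambda>x. real x ^ k * ln (real x) ^ (2 ^ k - k - 1))"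
proof -
  define N where "N = 2 ^ k - k - 1"
  define S where "S x = (\<Sum>n\<in>{1..k} \<rightarrow>\<^sub>E {1..x}. prod_over_lcm k n)" for x
  define g where "g x = real x ^ k * ln (real x) ^ N" for x
  obtain A where A: "A > 0" and lower: "\<forall>\<^sub>F x in sequentially. A * g x \<le> S x"
    unfolding g_def S_def N_def using sum_prod_over_lcm_ge[of k] by blast
  \<comment> \<open>The value \<open>2 ^ N\<close> comes from 1 + ln x <= 2 ln x for x >= 3; the
    maximum ensures \<open>A <= B\<close>.\<close>
  define B where "B = max A (2 ^ N)"
  have B: "A \<le> B" "2 ^ N \<le> B" by (simp_all add: B_def)
  have ev: "\<forall>\<^sub>F x in sequentially. A * g x \<le> S x \<and> S x \<le> B * g x \<and> x > 0 \<and> ln (real x) > 0"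
    using lower eventually_ge_at_top[of 3]
  proof eventually_elim
    case (elim x)
    have "exp 1 \<le> real x" using exp_le elim by linarith
    then have l: "ln (real x) \<ge> 1" using elim by (subst ln_ge_iff) auto
    have "S x \<le> real x ^ k * (1 + ln (real x)) ^ N"
      unfolding S_def N_def using elim by (intro sum_prod_over_lcm_le) auto
    also have "\<dots> \<le> real x ^ k * (2 * ln (real x)) ^ N"
      using l by (intro mult_left_mono power_mono) auto
    also have "\<dots> = 2 ^ N * g x" by (simp add: g_def power_mult_distrib)
    also have "\<dots> \<le> B * g x" using B l by (intro mult_right_mono) (auto simp: g_def)
    finally show ?case using elim l by simp
  qed
  have "\<forall>\<^sub>F x in sequentially. \<forall>(M :: 'a measure) X. indep_uniform_vars M k x X \<longrightarrow>
      A * ln (real x) ^ N \<le> prob_space.expectation M (\<lambda>\<omega>. prod_over_lcm k (\<lambda>i. X i \<omega>)) \<and>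
      prob_space.expectation M (\<lambda>\<omega>. prod_over_lcm k (\<lambda>i. X i \<omega>)) \<le> B * ln (real x) ^ N"
    using ev
  proof (eventually_elim, intro allI impI)
    fix x and M :: "'a measure" and X
    assume x: "A * g x \<le> S x \<and> S x \<le> B * g x \<and> x > 0 \<and> ln (real x) > 0" and X: "indep_uniform_vars M k x X"
    have "prob_space.expectation M (\<lambda>\<omega>. prod_over_lcm k (\<lambda>i. X i \<omega>)) = S x / real x ^ k"
      unfolding S_def using X x by (intro expectation_prod_over_lcm) auto
    moreover have "real x ^ k > 0" using x by simp
    ultimately show "A * ln (real x) ^ N \<le> prob_space.expectation M (\<lambda>\<omega>. prod_over_lcm k (\<lambda>i. X i \<omega>)) \<and>
      prob_space.expectation M (\<lambda>\<omega>. prod_over_lcm k (\<lambda>i. X i \<omega>)) \<le> B * ln (real x) ^ N"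
      using x by (simp add: g_def pos_le_divide_eq pos_divide_le_eq mult_ac)
  qed
  moreover have "S \<in> \<Theta>(g)"
  proof (rule bigthetaI')
    show "A > 0" "B > 0" using A B by auto
    show "\<forall>\<^sub>F x in sequentially. A * norm (g x) \<le> norm (S x) \<and> norm (S x) \<le> B * norm (g x)"
      using ev
    proof eventually_elim
      case (elim x)
      then have "g x \<ge> 0" by (simp add: g_def)
      moreover from this have "S x \<ge> 0" using elim A by (meson mult_nonneg_nonneg less_imp_le order_trans)
      ultimately show ?case using elim by simp
    qed
  qed
  ultimately show ?thesis
    unfolding N_def S_def g_def using A B(1) by blast
qed

end
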